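(* Let $h>0$ be fixed, let $L$ and $Q$ be the finite-dimensional (bounded) space-discretization operators on $\mathbb{R}^{\mathcal N}$ described in the context, where $(L,Q)$ is either the pair $(L^{\rm 4th}_h,Q^{\rm 4th}_h)$ (square domain) or the pair $(L^{\rm 4th}_{{\rm i},h},Q^{\rm 4th}_{{\rm i},h})$ (domain with a hole, ghost points). Let $\varepsilon_0>0$ and $t_{\rm fin}>0$. For $\varepsilon\in(0,\varepsilon_0]$ let $c^0_{\varepsilon,h}\in\mathbb{R}^{\mathcal N}$ be bounded uniformly in $\varepsilon$, let $\vec u_h$ be a given bounded (measurable) $1$-periodic function of time with values in $\mathbb{R}^{\mathcal N}\times\mathbb{R}^{\mathcal N}$, and let $c_{\varepsilon,h}:[0,t_{\rm fin}]\to\mathbb{R}^{\mathcal N}$ be the solution of $$\partial_t c_{\varepsilon,h}(t)=\big(L+Q(\vec u_h(t/\varepsilon))\big)c_{\varepsilon,h}(t),\qquad c_{\varepsilon,h}(0)=c^0_{\varepsilon,h}.$$ For $M\in\mathbb{N}$, $M\ge 1$, put $\Delta t=t_{\rm fin}/M$ and $t^n=n\Delta t$, and write $Q_s:=Q(\vec u_h(s/\varepsilon))$. For $n=0,\dots,M-1$ define the operators on $\mathbb{R}^{\mathcal N}$ (depending on $n$ and $\varepsilon$) $$\mathcal A^1_{\Delta t}=I-\Delta t\,L-\int_{t^n}^{t^{n+1}}Q_s\,ds,\qquad \mathcal A^2_{\Delta t}=\mathcal A^1_{\Delta t}-\mathbb M_2,\qquad \mathcal A^3_{\Delta t}=\mathcal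 A^2_{\Delta t}-\mathbb M_3,$$ where $$\mathbb M_2=-\tfrac12 L^2\Delta t^2-\int_{t^n}^{t^{n+1}}\!\!\int_s^{t^{n+1}}L\,Q_\sigma\,d\sigma\,ds-\int_{t^n}^{t^{n+1}}(t^{n+1}-s)\,Q_s L\,ds-\int_{t^n}^{t^{n+1}}\!\!\int_s^{t^{n+1}}Q_sQ_\sigma\,d\sigma\,ds$$ and $$\begin{aligned}\mathbb M_3={}&\tfrac12 L^3\int_{t^n}^{t^{n+1}}(t^{n+1}-s)^2\,ds+\int_{t^n}^{t^{n+1}}\!\!\int_s^{t^{n+1}}\!\!\int_\sigma^{t^{n+1}}L^2Q_\rho\,d\rho\,d\sigma\,ds\\&+\int_{t^n}^{t^{n+1}}\!\!\int_s^{t^{n+1}}(t^{n+1}-\sigma)\,L\,Q_\sigma L\,d\sigma\,ds+\int_{t^n}^{t^{n+1}}\!\!\int_s^{t^{n+1}}\!\!\int_\sigma^{t^{n+1}}L\,Q_\sigma Q_\rho\,d\rho\,d\sigma\,ds\\&+\tfrac12\int_{t^n}^{t^{n+1}}(t^{n+1}-s)^2\,Q_sL^2\,ds+\int_{t^n}^{t^{n+1}}\!\!\int_s^{t^{n+1}}\!\!\int_\sigma^{t^{n+1}}Q_s\,L\,Q_\rho\,d\rho\,d\sigma\,ds\\&+\int_{t^n}^{t^{n+1}}\!\!\int_s^{t^{n+1}}(t^{n+1}-\sigma)\,Q_sQ_\sigma L\,d\sigma\,ds+\int_{t^n}^{t^{n+1}}\!\!\int_s^{t^{n+1}}\!\!\int_\sigma^{t^{n+1}}Q_sQ_\sigma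 Q_\rho\,d\rho\,d\sigma\,ds.\end{aligned}$$ Then there exists a constant $\Delta t_0>0$, independent of $\varepsilon$, such that for all $\Delta t=t_{\rm fin}/M<\Delta t_0$ the following hold. (i) The operator $\mathcal A^3_{\Delta t}$ is invertible on $\mathbb{R}^{\mathcal N}$ (for every $n=0,\dots,M-1$ and every $\varepsilon\in(0,\varepsilon_0]$). (ii) The scheme $$c^0_{\varepsilon,h}=c_{\varepsilon,h}(0),\qquad c^{n+1}_{\varepsilon,h}=(\mathcal A^3_{\Delta t})^{-1}c^n_{\varepsilon,h},\quad n=0,\dots,M-1,$$ is of third order, uniformly in $\varepsilon$: there is a constant $K$, independent of $\varepsilon$ (and of $\Delta t$ and $n$), such that $$\|c_{\varepsilon,h}(t^n)-c^n_{\varepsilon,h}\|\le K\,\Delta t^3\qquad\text{for all } n=1,\dots,M.$$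
   Context: Setting. The problem is a semi-discretization in space, with fixed mesh size $h>0$, of the two-dimensional advection-diffusion equation $\partial_t c_\varepsilon=D\Delta c_\varepsilon+\nabla\cdot(c_\varepsilon\,\vec u(t/\varepsilon))$, with diffusion coefficient $D>0$ and a known velocity $\vec u=(u^x,u^y)$ that is $\varepsilon$-periodic in time. Active points. $\mathcal N$ is the number of active points $(x_i,y_j)=(ih,jh)$ of a uniform Cartesian grid. In the square-domain case all grid points of the square are active. In the case of a square with a disc $\mathcal B$ removed, the active points are the grid points of the square lying outside the disc together with the ghost points, i.e. the grid points in the disc having at least one of their four nearest grid neighbours outside the disc. A vector $c\in\mathbb{R}^{\mathcal N}$ has components $c_{i,j}$ indexed by active points, and $\vec u_h(t)=(u^x_{i,j}(t),u^y_{i,j}(t))\in\mathbb{R}^{\mathcal N}\times\mathbb{R}^{\mathcal N}$ collects the two velocity components at the active points. Operators. $L$ is a fixed real $\mathcal N\times\mathcal N$ matrix (depending on $h$, not on $\varepsilon$ or time). $Q$ is a fixed linear map $\vec u_h\mapsto Q(\vec u_h)$ from $\mathbb{R}^{\mathcal N}\times\mathbb{R}^{\mathcal N}$ to real $\mathcal N\times\mathcal N$ matrices (depending on $h$, not on $\varepsilon$ or time). At the domain points whose 9-point stencil (5 points in each coordinate direction) consists of active points, the rows are $$(Lc)_{i,j}=\tfrac{D}{12h^2}\big(-c_{i,j-2}+16c_{i,j-1}+16c_{i,j+1}-c_{i,j+2}-c_{i-2,j}+16c_{i-1,j}+16c_{i+1,j}-c_{i+2,j}-60c_{i,j}\big),$$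 $$(Q(\vec u_h)c)_{i,j}=\tfrac1{12h}\big(u^x_{i-2,j}c_{i-2,j}-8u^x_{i-1,j}c_{i-1,j}+8u^x_{i+1,j}c_{i+1,j}-u^x_{i+2,j}c_{i+2,j}\big)+\tfrac1{12h}\big(u^y_{i,j-2}c_{i,j-2}-8u^y_{i,j-1}c_{i,j-1}+8u^y_{i,j+1}c_{i,j+1}-u^y_{i,j+2}c_{i,j+2}\big).$$ The remaining rows (points on or next to the boundary, and ghost points) are fixed linear closures encoding extrapolation, interpolation and boundary conditions. They are linear in $c$ (and, for $Q$, also linear in $\vec u_h$) with coefficients independent of $\varepsilon$ and of time. The result is to be read for any such fixed closure. Conventions. $\|\cdot\|$ is a fixed norm on $\mathbb{R}^{\mathcal N}$; $I$ is the identity; products such as $Q_sQ_\sigma$ are compositions of operators. The quantities $h$, $\mathcal N$, $L$, $Q$, $\vec u_h$, $t_{\rm fin}$, $\varepsilon_0$ are fixed, and the constants $\Delta t_0$ and $K$ may depend on them. If $\vec u_h$ is not continuous, the differential equation is understood in integrated form. *)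

theory Defs
  imports "HOL-Analysis.Analysis"
begin

definition grid_points :: "real \<Rightarrow> (real \<times> real) set \<Rightarrow> (int \<times> int) set" where
  "grid_points h X = {(i, j). (of_int i * h, of_int j * h) \<in> X}"

definition is_square :: "(real \<times> real) set \<Rightarrow> bool" where
  "is_square S \<longleftrightarrow> (\<exists>a b l. l > 0 \<and>
     (S = {a..a + l} \<times> {b..b + l} \<or> S = {a<..<a + l} \<times> {b<..<b + l}))"

definition is_disc :: "(real \<times> real) set \<Rightarrow> bool" where
  "is_disc B \<longleftrightarrow> (\<exists>z r. r > 0 \<and> (B = ball z r \<or> B = cball z r))"

definition ghost_points :: "real \<Rightarrow> (real \<times> real) set \<Rightarrow> (int \<times> int) set" where
  "ghost_points h B = {(i, j). (i, j) \<in> grid_points h B \<and>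
     \<not> {(i - 1, j), (i + 1, j), (i, j - 1), (i, j + 1)} \<subseteq> grid_points h B}"

text \<open>\<open>G\<close> are the grid points of the domain and \<open>P\<close> the active points; they differ by the
  ghost points when a disc is removed from the square.\<close>

definition domain_grid :: "real \<Rightarrow> (int \<times> int) set \<Rightarrow> (int \<times> int) set \<Rightarrow> bool" where
  "domain_grid h G P \<longleftrightarrow> (\<exists>S. is_square S \<and>
     (G = grid_points h S \<and> P = G \<or>
      (\<exists>B. is_disc B \<and> B \<subseteq> S \<and> G = grid_points h (S - B) \<and> P = G \<union> ghost_points h B)))"

definition stencil :: "int \<Rightarrow> int \<Rightarrow> (int \<times> int) set" where
  "stencil i j = {(i + k, j) | k. k \<in> {-2..2}} \<union> {(i, j + k) | k. k \<in> {-2..2}}"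

text \<open>The space of grid functions is \<open>real ^ 'n\<close>, where \<open>p :: 'n \<Rightarrow> int \<times> int\<close> enumerates the
  active points bijectively; \<open>at_pt p c i j\<close> is the component \<open>c\<^sub>i\<^sub>,\<^sub>j\<close>, meaningful only when
  \<open>(i, j)\<close> is active.\<close>

definition at_pt :: "('n::finite \<Rightarrow> int \<times> int) \<Rightarrow> real ^ 'n \<Rightarrow> int \<Rightarrow> int \<Rightarrow> real" where
  "at_pt p c i j = c $ inv p (i, j)"

text \<open>Only the rows at domain points with a fully active stencil are prescribed. All other rows
  of \<open>L\<close> and \<open>Q\<close> (the closures) are left arbitrary.\<close>

definition diffusion_rows ::
  "real \<Rightarrow> real \<Rightarrow> (int \<times> int) set \<Rightarrow> ('n::finite \<Rightarrow> int \<times> int) \<Rightarrow> real ^ 'n ^ 'n \<Rightarrow> bool" where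
  "diffusion_rows D h G p L \<longleftrightarrow>
    (\<forall>i j c. (i, j) \<in> G \<longrightarrow> stencil i j \<subseteq> range p \<longrightarrow>
      at_pt p (L *v c) i j = D / (12 * h\<^sup>2) *
        (- at_pt p c i (j - 2) + 16 * at_pt p c i (j - 1)
         + 16 * at_pt p c i (j + 1) - at_pt p c i (j + 2)
         - at_pt p c (i - 2) j + 16 * at_pt p c (i - 1) j
         + 16 * at_pt p c (i + 1) j - at_pt p c (i + 2) j
         - 60 * at_pt p c i j))"

definition advection_rows ::
  "real \<Rightarrow> (int \<times> int) set \<Rightarrow> ('n::finite \<Rightarrow> int \<times> int)
     \<Rightarrow> ((real ^ 'n) \<times> (real ^ 'n) \<Rightarrow> real ^ 'n ^ 'n) \<Rightarrow> bool" where
  "advection_rows h G p Q \<longleftrightarrow>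
    (\<forall>i j c ux uy. (i, j) \<in> G \<longrightarrow> stencil i j \<subseteq> range p \<longrightarrow>
      at_pt p (Q (ux, uy) *v c) i j =
        1 / (12 * h) *
          (at_pt p ux (i - 2) j * at_pt p c (i - 2) j
           - 8 * at_pt p ux (i - 1) j * at_pt p c (i - 1) j
           + 8 * at_pt p ux (i + 1) j * at_pt p c (i + 1) j
           - at_pt p ux (i + 2) j * at_pt p c (i + 2) j)
      + 1 / (12 * h) *
          (at_pt p uy i (j - 2) * at_pt p c i (j - 2)
           - 8 * at_pt p uy i (j - 1) * at_pt p c i (j - 1)
           + 8 * at_pt p uy i (j + 1) * at_pt p c i (j + 1)
           - at_pt p uy i (j + 2) * at_pt p c i (j + 2)))"

definition is_norm :: "('a::real_vector \<Rightarrow> real) \<Rightarrow> bool" where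
  "is_norm nrm \<longleftrightarrow> (\<forall>x. nrm x \<ge> 0) \<and> (\<forall>x. nrm x = 0 \<longleftrightarrow> x = 0) \<and>
     (\<forall>a x. nrm (a *\<^sub>R x) = \<bar>a\<bar> * nrm x) \<and> (\<forall>x y. nrm (x + y) \<le> nrm x + nrm y)"

text \<open>Integrated form of \<open>c' = B c\<close>, \<open>c 0 = c0\<close> on \<open>{0..T}\<close>. Continuity of \<open>c\<close> on \<open>{0..T}\<close> is
  implied, since indefinite integrals are continuous.\<close>

definition solves_ode ::
  "real \<Rightarrow> (real \<Rightarrow> real ^ 'n ^ 'n) \<Rightarrow> real ^ 'n \<Rightarrow> (real \<Rightarrow> real ^ 'n::finite) \<Rightarrow> bool" where
  "solves_ode T B c0 c \<longleftrightarrow> c 0 = c0 \<and>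
     (\<forall>t\<in>{0..T}. ((\<lambda>s. B s *v c s) has_integral (c t - c 0)) {0..t})"

text \<open>In the operators below, \<open>q s\<close> stands for \<open>Q (u (s / \<epsilon>))\<close>, and \<open>a\<close>, \<open>b\<close> are the end points
  of the time step \<open>n\<close>.\<close>

definition step_op1 ::
  "real ^ 'n ^ 'n \<Rightarrow> (real \<Rightarrow> real ^ 'n ^ 'n) \<Rightarrow> real \<Rightarrow> nat \<Rightarrow> real ^ 'n ^ 'n::finite" where
  "step_op1 L q dt n =
    (let a = real n * dt; b = real (n + 1) * dt in
      mat 1 - dt *\<^sub>R L - integral {a..b} q)"

definition corr2 ::
  "real ^ 'n ^ 'n \<Rightarrow> (real \<Rightarrow> real ^ 'n ^ 'n) \<Rightarrow> real \<Rightarrow> nat \<Rightarrow> real ^ 'n ^ 'n::finite" where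
  "corr2 L q dt n =
    (let a = real n * dt; b = real (n + 1) * dt in
      - ((1 / 2 * dt\<^sup>2) *\<^sub>R (L ** L))
      - integral {a..b} (\<lambda>s. integral {s..b} (\<lambda>\<sigma>. L ** q \<sigma>))
      - integral {a..b} (\<lambda>s. (b - s) *\<^sub>R (q s ** L))
      - integral {a..b} (\<lambda>s. integral {s..b} (\<lambda>\<sigma>. q s ** q \<sigma>)))"

definition corr3 ::
  "real ^ 'n ^ 'n \<Rightarrow> (real \<Rightarrow> real ^ 'n ^ 'n) \<Rightarrow> real \<Rightarrow> nat \<Rightarrow> real ^ 'n ^ 'n::finite" where
  "corr3 L q dt n =
    (let a = real n * dt; b = real (n + 1) * dt in
      (1 / 2 * integral {a..b} (\<lambda>s. (b - s)\<^sup>2)) *\<^sub>R (L ** L ** L)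
      + integral {a..b} (\<lambda>s. integral {s..b} (\<lambda>\<sigma>. integral {\<sigma>..b} (\<lambda>\<rho>. L ** L ** q \<rho>)))
      + integral {a..b} (\<lambda>s. integral {s..b} (\<lambda>\<sigma>. (b - \<sigma>) *\<^sub>R (L ** q \<sigma> ** L)))
      + integral {a..b} (\<lambda>s. integral {s..b} (\<lambda>\<sigma>. integral {\<sigma>..b} (\<lambda>\<rho>. L ** q \<sigma> ** q \<rho>)))
      + (1 / 2) *\<^sub>R integral {a..b} (\<lambda>s. (b - s)\<^sup>2 *\<^sub>R (q s ** L ** L))
      + integral {a..b} (\<lambda>s. integral {s..b} (\<lambda>\<sigma>. integral {\<sigma>..b} (\<lambda>\<rho>. q s ** L ** q \<rho>)))
      + integral {a..b} (\<lambda>s. integral {s..b} (\<lambda>\<sigma>. (b - \<sigma>) *\<^sub>R (q s ** q \<sigma> ** L)))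
      + integral {a..b} (\<lambda>s. integral {s..b} (\<lambda>\<sigma>. integral {\<sigma>..b} (\<lambda>\<rho>. q s ** q \<sigma> ** q \<rho>))))"

definition step_op2 ::
  "real ^ 'n ^ 'n \<Rightarrow> (real \<Rightarrow> real ^ 'n ^ 'n) \<Rightarrow> real \<Rightarrow> nat \<Rightarrow> real ^ 'n ^ 'n::finite" where
  "step_op2 L q dt n = step_op1 L q dt n - corr2 L q dt n"

definition step_op3 ::
  "real ^ 'n ^ 'n \<Rightarrow> (real \<Rightarrow> real ^ 'n ^ 'n) \<Rightarrow> real \<Rightarrow> nat \<Rightarrow> real ^ 'n ^ 'n::finite" where
  "step_op3 L q dt n = step_op2 L q dt n - corr3 L q dt n"

primrec implicit_scheme ::
  "(nat \<Rightarrow> real ^ 'n ^ 'n) \<Rightarrow> real ^ 'n::finite \<Rightarrow> nat \<Rightarrow> real ^ 'n" where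
  "implicit_scheme A c0 0 = c0"
| "implicit_scheme A c0 (Suc n) = matrix_inv (A n) *v implicit_scheme A c0 n"

end

theory Submission
  imports Defs
begin

text \<open>Write \<open>B s = L + q s\<close>. On a step \<open>{a..b}\<close> the solution satisfies
  \<open>c s = c b - (integral of B c over {s..b})\<close>. Inserting this relation into itself expresses
  \<open>c a\<close> through the end value \<open>c b\<close>:
  \<open>c a = (J\<^sub>0 - J\<^sub>1 + J\<^sub>2 - J\<^sub>3) c b + R\<close>, where \<open>J\<^sub>0 = I\<close> and
  \<open>J\<^sub>k\<^sub>+\<^sub>1\<close> is the integral of \<open>B J\<^sub>k\<close> from the current time up to \<open>b\<close>. These are the terms of
  the Dyson series run backwards in time (\<open>backward_dyson\<close>). Expanding every product
  \<open>(L + q) \<cdots> (L + q)\<close> in \<open>J\<^sub>1\<close>, \<open>J\<^sub>2\<close>, \<open>J\<^sub>3\<close> and evaluating the integrals over variables that only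
  meet \<open>L\<close> produces the two, four and eight terms of the third-order step operator, so this
  operator is exactly \<open>J\<^sub>0 - J\<^sub>1 + J\<^sub>2 - J\<^sub>3\<close> (\<open>step_op3_eq_dyson\<close>).

  Two estimates then suffice. If \<open>\<beta>\<close> bounds the operators \<open>B s\<close>, each \<open>J\<^sub>k\<close> is bounded by
  \<open>(\<beta> \<Delta>t) ^ k\<close> (\<open>norm_backward_dyson_le\<close>) and the remainder \<open>R\<close> by a multiple of \<open>(\<beta> \<Delta>t) ^ 4\<close> (\<open>dyson_remainder\<close>), the multiple
  being a Gronwall bound for the solution. Hence the local error is of fourth order
  (\<open>step_op3_consistency\<close>), and the step operator differs from the identity by at most
  \<open>3 \<beta> \<Delta>t\<close> as long as \<open>\<beta> \<Delta>t \<le> 1\<close> (\<open>step_op3_lower_bound\<close>).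
  For \<open>\<Delta>t < 1 / (6 \<beta>)\<close> it is therefore injective, so invertible, and the norm of
  its inverse is at most \<open>exp (6 \<beta> \<Delta>t)\<close>. Adding up \<open>M = t_fin / \<Delta>t\<close> local errors loses one power of \<open>\<Delta>t\<close> (\<open>implicit_scheme_error\<close>). These estimates are in the Euclidean norm and carry over
  to any other norm by equivalence.

  Uniformity in \<open>\<epsilon>\<close> holds because \<open>\<epsilon>\<close> only rescales time inside a bounded function: \<open>\<beta>\<close> can be
  taken from the range of the velocity, and no derivative in time of the coefficients ever
  occurs.\<close>

section \<open>Matrix products as bounded bilinear maps\<close>

lemma matrix_add_rdistrib: "(A + B) ** C = A ** C + B ** C"
  by (vector matrix_matrix_mult_def sum.distrib[symmetric] distrib_right)

lemma bounded_bilinear_matrix_matrix_mult: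
  "bounded_bilinear ((**) :: real^'n^'m \<Rightarrow> real^'k^'n \<Rightarrow> real^'k^'m)"
  unfolding bilinear_conv_bounded_bilinear[symmetric] bilinear_def
  by (intro conjI allI linearI)
     (simp_all add: matrix_add_ldistrib matrix_add_rdistrib matrix_scalar_ac scalar_matrix_assoc)

lemma bounded_bilinear_matrix_vector_mult:
  "bounded_bilinear ((*v) :: real^'n^'m \<Rightarrow> real^'n \<Rightarrow> real^'m)"
  unfolding bilinear_conv_bounded_bilinear[symmetric] bilinear_def
  by (intro conjI allI linearI)
     (simp_all add: matrix_vector_mult_add_rdistrib matrix_vector_right_distrib
        matrix_vector_mult_scaleR scaleR_matrix_vector_assoc)

section \<open>Bounded measurable integrands\<close>

text \<open>The nested integrals contain products of coefficients. Integrability is not preserved by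
  products, whereas boundedness and measurability are, and together they imply integrability.\<close>

definition bounded_measurable :: "real \<Rightarrow> real \<Rightarrow> (real \<Rightarrow> 'a::euclidean_space) \<Rightarrow> bool" where
  "bounded_measurable a b f \<longleftrightarrow>
     f \<in> borel_measurable (lebesgue_on {a..b}) \<and> bounded (f ` {a..b})"

lemma bounded_measurable_bilinear:
  fixes f :: "real \<Rightarrow> 'a::euclidean_space" and g :: "real \<Rightarrow> 'b::euclidean_space"
    and m :: "'a \<Rightarrow> 'b \<Rightarrow> 'c::euclidean_space"
  assumes m: "bounded_bilinear m" and f: "bounded_measurable a b f" and g: "bounded_measurable a b g"
  shows "bounded_measurable a b (\<lambda>s. m (f s) (g s))"
proof -
  interpret m: bounded_bilinear m by fact
  obtain K where K: "\<And>x y. norm (m x y) \<le> norm x * norm y * K" "K > 0"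
    using m.pos_bounded by metis
  obtain F where F: "\<And>s. s \<in> {a..b} \<Longrightarrow> norm (f s) \<le> F"
    using f unfolding bounded_measurable_def bounded_iff by blast
  obtain G where G: "\<And>s. s \<in> {a..b} \<Longrightarrow> norm (g s) \<le> G"
    using g unfolding bounded_measurable_def bounded_iff by blast
  have "norm (m (f s) (g s)) \<le> F * G * K" if "s \<in> {a..b}" for s
  proof -
    have "0 \<le> F" using F[OF that] norm_ge_zero order_trans by blast
    then show ?thesis
      using K F[OF that] G[OF that]
      by (intro order_trans[OF K(1)] mult_right_mono mult_mono) auto
  qed
  moreover have "(\<lambda>s. m (f s) (g s)) \<in> borel_measurable (lebesgue_on {a..b})"
    using f g
    by (intro borel_measurable_continuous_Pair[where H=m])
       (auto simp: bounded_measurable_def intro!: m.continuous_on continuous_intros)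
  ultimately show ?thesis unfolding bounded_measurable_def bounded_iff by blast
qed

lemmas bounded_measurable_mult =
  bounded_measurable_bilinear[OF bounded_bilinear_matrix_matrix_mult]
lemmas bounded_measurable_mult_vec =
  bounded_measurable_bilinear[OF bounded_bilinear_matrix_vector_mult]

lemma bounded_measurable_add:
  "bounded_measurable a b f \<Longrightarrow> bounded_measurable a b g \<Longrightarrow> bounded_measurable a b (\<lambda>s. f s + g s)"
  by (simp add: bounded_measurable_def bounded_plus_comp borel_measurable_add)

lemma bounded_measurable_continuous:
  "continuous_on {a..b} f \<Longrightarrow> bounded_measurable a b f"
  by (simp add: bounded_measurable_def compact_imp_bounded compact_continuous_image
      continuous_imp_measurable_on_sets_lebesgue)

lemma bounded_measurable_const: "bounded_measurable a b (\<lambda>s. c)"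
  by (rule bounded_measurable_continuous) simp

lemma bounded_measurable_subinterval:
  assumes "bounded_measurable a b f" "a \<le> a'" "b' \<le> b"
  shows "bounded_measurable a' b' f"
proof -
  have sub: "{a'..b'} \<subseteq> {a..b}" using assms(2,3) by auto
  have "f \<in> borel_measurable (lebesgue_on {a'..b'})"
    using assms(1) measurable_restrict_mono[OF _ sub] unfolding bounded_measurable_def by blast
  moreover have "bounded (f ` {a'..b'})"
    using assms(1) bounded_subset[OF _ image_mono[OF sub]] unfolding bounded_measurable_def by blast
  ultimately show ?thesis by (simp add: bounded_measurable_def)
qed

lemma bounded_measurable_integrable:
  fixes f :: "real \<Rightarrow> 'a::euclidean_space"
  assumes "bounded_measurable a b f"
  shows "f integrable_on {a..b}"
proof -
  obtain F where F: "\<And>s. s \<in> {a..b} \<Longrightarrow> norm (f s) \<le> F"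
    using assms unfolding bounded_measurable_def bounded_iff by blast
  have "(\<lambda>_. F) integrable_on {a..b}" by (rule integrable_const_ivl)
  with assms F have "f absolutely_integrable_on {a..b}"
    by (intro measurable_bounded_by_integrable_imp_absolutely_integrable[where g="\<lambda>_. F"])
       (simp_all add: bounded_measurable_def)
  then show ?thesis by (rule set_lebesgue_integral_eq_integral)
qed

lemma bounded_measurable_integrable_tail:
  fixes f :: "real \<Rightarrow> 'a::euclidean_space"
  assumes "bounded_measurable a b f" "s \<in> {a..b}"
  shows "f integrable_on {s..b}"
  by (rule bounded_measurable_integrable[OF bounded_measurable_subinterval[OF assms(1)]])
     (use assms(2) in auto)

text \<open>Indefinite integrals are continuous, so the class is closed under the nesting in the correction
  terms.\<close>

lemma bounded_measurable_tail_integral: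
  fixes f :: "real \<Rightarrow> 'a::euclidean_space"
  assumes "bounded_measurable a b f"
  shows "bounded_measurable a b (\<lambda>s. integral {s..b} f)"
  by (rule bounded_measurable_continuous[OF indefinite_integral_continuous_1'[OF
      bounded_measurable_integrable[OF assms]]])

lemma norm_integral_le_bound:
  fixes f :: "real \<Rightarrow> 'a::euclidean_space"
  assumes "f integrable_on {a..b}" "a \<le> b" "\<And>s. s \<in> {a..b} \<Longrightarrow> norm (f s) \<le> C"
  shows "norm (integral {a..b} f) \<le> C * (b - a)"
proof -
  have "0 \<le> C" using order_trans[OF norm_ge_zero assms(3)[of a]] assms(2) by simp
  then show ?thesis
    using has_integral_bound_real[OF _ finite.emptyI integrable_integral[OF assms(1)], of C] assms
    by simp
qed

lemma integral_matrix_mult_vec: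
  fixes f :: "real \<Rightarrow> real^'n::finite^'m::finite"
  assumes "f integrable_on S"
  shows "integral S f *v x = integral S (\<lambda>s. f s *v x)"
  using integral_linear[OF assms bounded_bilinear.bounded_linear_left[OF bounded_bilinear_matrix_vector_mult, of x]]
  by (simp add: o_def)

lemma integral_matrix_mult_left:
  fixes f :: "real \<Rightarrow> real^'n::finite^'m::finite" and A :: "real^'m^'k::finite"
  assumes "f integrable_on S"
  shows "integral S (\<lambda>s. A ** f s) = A ** integral S f"
  using integral_linear[OF assms
      bounded_bilinear.bounded_linear_right[OF bounded_bilinear_matrix_matrix_mult, of A]]
  by (simp add: o_def)

text \<open>A composition of Lebesgue measurable functions need not be Lebesgue measurable. Here the inner
  function is a scaling of the line, under which preimages of Lebesgue sets are Lebesgue sets.\<close>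

lemma linear_image_rescaled_measurable:
  fixes u :: "real \<Rightarrow> 'a::euclidean_space" and Q :: "'a \<Rightarrow> 'b::euclidean_space"
  assumes "linear Q" "u \<in> borel_measurable lebesgue" "bounded (range u)"
  shows "bounded_measurable a b (\<lambda>s. Q (u (s / \<epsilon>)))"
proof -
  have "(\<lambda>s. u ((1 / \<epsilon>) *\<^sub>R s)) \<in> borel_measurable lebesgue"
    by (rule measurable_compose[OF lebesgue_measurable_scaling assms(2)])
  moreover have "Q \<in> borel_measurable borel"
    by (intro borel_measurable_continuous_onI linear_continuous_on)
       (simp add: assms linear_conv_bounded_linear[symmetric])
  ultimately have "(\<lambda>s. Q (u ((1 / \<epsilon>) *\<^sub>R s))) \<in> borel_measurable lebesgue"
    by (rule measurable_compose)
  then have "(\<lambda>s. Q (u (s / \<epsilon>))) \<in> borel_measurable (lebesgue_on {a..b})"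
    by (intro measurable_restrict_space1) simp
  moreover have "bounded ((\<lambda>s. Q (u (s / \<epsilon>))) ` {a..b})"
    by (rule bounded_subset[OF bounded_linear_image[OF assms(3)]])
       (auto simp: assms linear_conv_bounded_linear[symmetric])
  ultimately show ?thesis by (simp add: bounded_measurable_def)
qed

section \<open>The backward Dyson series\<close>

text \<open>Picard iteration for \<open>X' = B X\<close> with the terminal condition \<open>X b = I\<close> gives the alternating sum
  of these terms: the sign \<open>(- 1) ^ k\<close>, which comes from integrating backwards in time, is left out
  of the \<open>k\<close>-th term.\<close>

primrec backward_dyson ::
  "(real \<Rightarrow> real ^ 'n ^ 'n) \<Rightarrow> real \<Rightarrow> nat \<Rightarrow> real \<Rightarrow> real ^ 'n::finite ^ 'n" where
  "backward_dyson B b 0 s = mat 1"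
| "backward_dyson B b (Suc k) s = integral {s..b} (\<lambda>\<sigma>. B \<sigma> ** backward_dyson B b k \<sigma>)"

lemma bounded_measurable_dyson:
  assumes "bounded_measurable a b B"
  shows "bounded_measurable a b (backward_dyson B b k)"
proof (induction k)
  case 0
  show ?case by (simp add: bounded_measurable_const)
next
  case (Suc k)
  show ?case
    using bounded_measurable_tail_integral[OF bounded_measurable_mult[OF assms Suc]] by simp
qed

lemma backward_dyson_Suc_vec:
  assumes "bounded_measurable a b B" "s \<in> {a..b}"
  shows "backward_dyson B b (Suc k) s *v x
    = integral {s..b} (\<lambda>\<sigma>. B \<sigma> *v (backward_dyson B b k \<sigma> *v x))"
proof -
  have "(\<lambda>\<sigma>. B \<sigma> ** backward_dyson B b k \<sigma>) integrable_on {s..b}"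
    by (rule bounded_measurable_integrable_tail[OF bounded_measurable_mult[OF assms(1)
        bounded_measurable_dyson[OF assms(1)]] assms(2)])
  then show ?thesis by (simp add: integral_matrix_mult_vec matrix_vector_mul_assoc)
qed

text \<open>The \<open>k\<close> nested integrals range over a simplex, which would give an additional factor
  \<open>1 / fact k\<close>; bounding the simplex by the cube keeps the induction simple and gives the same order.\<close>

lemma norm_backward_dyson_le:
  assumes B: "bounded_measurable a b B" and bd: "\<And>s x. s \<in> {a..b} \<Longrightarrow> norm (B s *v x) \<le> \<beta> * norm x"
    and "\<beta> \<ge> 0" and "s \<in> {a..b}"
  shows "norm (backward_dyson B b k s *v x) \<le> (\<beta> * (b - a)) ^ k * norm x"
  using \<open>s \<in> {a..b}\<close>
proof (induction k arbitrary: s)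
  case 0
  show ?case by simp
next
  case (Suc k)
  let ?C = "(\<beta> * (b - a)) ^ k * norm x"
  have C: "0 \<le> ?C" using \<open>\<beta> \<ge> 0\<close> Suc.prems by auto
  have "norm (backward_dyson B b (Suc k) s *v x) \<le> \<beta> * ?C * (b - s)"
    unfolding backward_dyson_Suc_vec[OF B Suc.prems]
  proof (rule norm_integral_le_bound)
    show "(\<lambda>\<sigma>. B \<sigma> *v (backward_dyson B b k \<sigma> *v x)) integrable_on {s..b}"
      by (rule bounded_measurable_integrable_tail[OF bounded_measurable_mult_vec[OF B
          bounded_measurable_mult_vec[OF bounded_measurable_dyson[OF B] bounded_measurable_const]]
          Suc.prems])
    show "norm (B \<sigma> *v (backward_dyson B b k \<sigma> *v x)) \<le> \<beta> * ?C" if "\<sigma> \<in> {s..b}" for \<sigma>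
    proof -
      have "\<sigma> \<in> {a..b}" using that Suc.prems by auto
      then show ?thesis
        using order_trans[OF bd mult_left_mono[OF Suc.IH \<open>\<beta> \<ge> 0\<close>]] by blast
    qed
  qed (use Suc.prems in auto)
  also have "\<dots> \<le> \<beta> * ?C * (b - a)"
    using C \<open>\<beta> \<ge> 0\<close> Suc.prems by (intro mult_left_mono) auto
  finally show ?case by (simp add: algebra_simps)
qed

text \<open>Subtracting the truncated series from the solution gives a quantity \<open>D\<^sub>k\<close> with
  \<open>D\<^sub>0 = c\<close> and \<open>D\<^sub>k\<^sub>+\<^sub>1 s = - (integral of B D\<^sub>k over {s..b})\<close>, since the integrated equation and the
  recursion for the series have the same form. Each step of the induction thus gains one factor
  \<open>\<beta> * (b - a)\<close>.\<close>

lemma dyson_remainder: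
  assumes B: "bounded_measurable a b B"
    and bd: "\<And>s x. s \<in> {a..b} \<Longrightarrow> norm (B s *v x) \<le> \<beta> * norm x" and "\<beta> \<ge> 0"
    and c: "bounded_measurable a b c"
    and C: "\<And>s. s \<in> {a..b} \<Longrightarrow> norm (c s) \<le> C"
    and eq: "\<And>s. s \<in> {a..b} \<Longrightarrow> c b - c s = integral {s..b} (\<lambda>\<sigma>. B \<sigma> *v c \<sigma>)"
    and "s \<in> {a..b}"
  shows "norm (c s - (\<Sum>j<k. (- 1) ^ j *\<^sub>R (backward_dyson B b j s *v c b))) \<le> (\<beta> * (b - a)) ^ k * C"
  using \<open>s \<in> {a..b}\<close>
proof (induction k arbitrary: s)
  case 0
  then show ?case using C by simp
next
  case (Suc k)
  let ?J = "backward_dyson B b" and ?s = "\<lambda>j. (- 1 :: real) ^ j"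
  let ?D = "\<lambda>s. c s - (\<Sum>j<k. ?s j *\<^sub>R (?J j s *v c b))"
  let ?E = "(\<beta> * (b - a)) ^ k * C"
  note tail = bounded_measurable_integrable_tail[OF _ Suc.prems]
  have Bc: "(\<lambda>\<sigma>. B \<sigma> *v c \<sigma>) integrable_on {s..b}"
    by (rule tail[OF bounded_measurable_mult_vec[OF B c]])
  have BJ: "(\<lambda>\<sigma>. B \<sigma> *v (?J j \<sigma> *v c b)) integrable_on {s..b}" for j
    by (rule tail[OF bounded_measurable_mult_vec[OF B bounded_measurable_mult_vec[OF
          bounded_measurable_dyson[OF B] bounded_measurable_const]]])
  have "((\<lambda>\<sigma>. B \<sigma> *v c \<sigma> - (\<Sum>j<k. ?s j *\<^sub>R (B \<sigma> *v (?J j \<sigma> *v c b)))) has_integral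
     (c b - c s) - (\<Sum>j<k. ?s j *\<^sub>R (?J (Suc j) s *v c b))) {s..b}"
    unfolding backward_dyson_Suc_vec[OF B Suc.prems] eq[OF Suc.prems]
    by (intro has_integral_diff has_integral_sum has_integral_cmul integrable_integral Bc BJ) auto
  moreover have "B \<sigma> *v c \<sigma> - (\<Sum>j<k. ?s j *\<^sub>R (B \<sigma> *v (?J j \<sigma> *v c b))) = B \<sigma> *v ?D \<sigma>" for \<sigma>
    by (simp add: matrix_vector_mult_diff_distrib linear_sum[OF matrix_vector_mul_linear]
        matrix_vector_mult_scaleR)
  moreover have "(c b - c s) - (\<Sum>j<k. ?s j *\<^sub>R (?J (Suc j) s *v c b))
      = - (c s - (\<Sum>j<Suc k. ?s j *\<^sub>R (?J j s *v c b)))"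
    unfolding sum.lessThan_Suc_shift by (simp add: sum_negf del: backward_dyson.simps(2))
  ultimately have D: "((\<lambda>\<sigma>. B \<sigma> *v ?D \<sigma>) has_integral
      - (c s - (\<Sum>j<Suc k. ?s j *\<^sub>R (?J j s *v c b)))) {s..b}"
    by (simp only:)
  have "norm (- (c s - (\<Sum>j<Suc k. ?s j *\<^sub>R (?J j s *v c b)))) \<le> \<beta> * ?E * (b - s)"
    unfolding integral_unique[OF D, symmetric]
  proof (rule norm_integral_le_bound)
    show "(\<lambda>\<sigma>. B \<sigma> *v ?D \<sigma>) integrable_on {s..b}" using D by blast
    show "norm (B \<sigma> *v ?D \<sigma>) \<le> \<beta> * ?E" if "\<sigma> \<in> {s..b}" for \<sigma>
    proof -
      have "\<sigma> \<in> {a..b}" using that Suc.prems by auto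
      then show ?thesis
        using order_trans[OF bd mult_left_mono[OF Suc.IH \<open>\<beta> \<ge> 0\<close>]] by blast
    qed
  qed (use Suc.prems in auto)
  also have "\<dots> \<le> \<beta> * ?E * (b - a)"
    using \<open>\<beta> \<ge> 0\<close> Suc.prems order_trans[OF norm_ge_zero C[OF Suc.prems]]
    by (intro mult_left_mono mult_nonneg_nonneg zero_le_power) auto
  finally show ?case by (simp only: norm_minus_cancel power_Suc mult_ac)
qed

section \<open>The step operator as a truncated Dyson series\<close>

lemma has_integral_distance_to_endpoint:
  fixes b s :: real
  assumes "s \<le> b"
  shows "((\<lambda>\<sigma>. b - \<sigma>) has_integral ((b - s)\<^sup>2 / 2)) {s..b}"
proof -
  have "((\<lambda>\<sigma>. b - \<sigma>) has_integral (- ((b - b)\<^sup>2 / 2) - - ((b - s)\<^sup>2 / 2))) {s..b}"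
    using assms
    by (intro fundamental_theorem_of_calculus)
       (auto intro!: derivative_eq_intros simp: has_real_derivative_iff_has_vector_derivative[symmetric] field_simps)
  then show ?thesis by simp
qed

text \<open>Both sides are reduced to the same normal form: \<open>q1\<close> is the tail integral of \<open>q\<close>, and
  \<open>W\<close>, \<open>X\<close>, \<open>Y\<close>, \<open>Z\<close> are the contributions of the products \<open>L L\<close>, \<open>L q\<close>, \<open>q L\<close>, \<open>q q\<close> to the
  second-order term. The eight third-order terms are the integrals of \<open>L\<close> and of \<open>q s\<close> times these
  four.\<close>

lemma step_op3_eq_dyson:
  fixes L :: "real ^ 'n::finite ^ 'n" and q :: "real \<Rightarrow> real ^ 'n ^ 'n" and n :: nat and dt :: real
  defines "a \<equiv> real n * dt" and "b \<equiv> real (n + 1) * dt"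
  assumes "dt \<ge> 0" and q: "bounded_measurable a b q"
  shows "step_op3 L q dt n = mat 1 - backward_dyson (\<lambda>s. L + q s) b 1 a
    + backward_dyson (\<lambda>s. L + q s) b 2 a - backward_dyson (\<lambda>s. L + q s) b 3 a"
proof -
  let ?J = "backward_dyson (\<lambda>s. L + q s) b"
  define q1 where "q1 s = integral {s..b} q" for s
  define X where "X s = integral {s..b} (\<lambda>\<sigma>. L ** q1 \<sigma>)" for s
  define Y where "Y s = integral {s..b} (\<lambda>\<sigma>. (b - \<sigma>) *\<^sub>R (q \<sigma> ** L))" for s
  define Z where "Z s = integral {s..b} (\<lambda>\<sigma>. q \<sigma> ** q1 \<sigma>)" for s
  define W where "W s = ((b - s)\<^sup>2 / 2) *\<^sub>R (L ** L)" for s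
  note bm_mult = bounded_measurable_mult and bm_const = bounded_measurable_const
    and tail = bounded_measurable_integrable_tail
    and bm_scaleR = bounded_measurable_bilinear[OF bounded_bilinear_scaleR]
  have aab: "a \<in> {a..b}" and ba: "b - a = dt"
    using \<open>dt \<ge> 0\<close> by (auto simp: a_def b_def algebra_simps)
  have q1: "bounded_measurable a b q1"
    using bounded_measurable_tail_integral[OF q] by (simp add: q1_def[abs_def])
  have bm_sq: "bounded_measurable a b (\<lambda>s. (b - s)\<^sup>2)"
    by (intro bounded_measurable_continuous continuous_intros)
  have bm_lin: "bounded_measurable a b (\<lambda>s. b - s)"
    by (intro bounded_measurable_continuous continuous_intros)
  have bmX: "bounded_measurable a b (\<lambda>s. L ** q1 s)"
    by (rule bm_mult[OF bm_const q1])
  have bmY: "bounded_measurable a b (\<lambda>s. (b - s) *\<^sub>R (q s ** L))"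
    by (rule bm_scaleR[OF bm_lin bm_mult[OF q bm_const]])
  have bmZ: "bounded_measurable a b (\<lambda>s. q s ** q1 s)"
    by (rule bm_mult[OF q q1])
  have X: "bounded_measurable a b X" and Y: "bounded_measurable a b Y" and Z: "bounded_measurable a b Z"
    using bounded_measurable_tail_integral[OF bmX] bounded_measurable_tail_integral[OF bmY]
      bounded_measurable_tail_integral[OF bmZ]
    by (simp_all add: X_def[abs_def] Y_def[abs_def] Z_def[abs_def])
  have W: "bounded_measurable a b W"
    unfolding W_def by (intro bounded_measurable_continuous continuous_intros ballI) simp

  have J1: "?J (Suc 0) s = (b - s) *\<^sub>R L + q1 s" if "s \<in> {a..b}" for s
    using integral_add[OF integrable_const_ivl tail[OF q that], of L] that by (simp add: q1_def)
  have J2: "?J (Suc (Suc 0)) s = W s + X s + Y s + Z s" if s: "s \<in> {a..b}" for s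
  proof -
    have "((\<lambda>\<sigma>. (b - \<sigma>) *\<^sub>R (L ** L)) has_integral W s) {s..b}"
      using has_integral_scaleR_left[OF has_integral_distance_to_endpoint[of s b], of "L ** L"] s
      by (simp add: W_def)
    then have w: "(\<lambda>\<sigma>. (b - \<sigma>) *\<^sub>R (L ** L)) integrable_on {s..b}"
      "integral {s..b} (\<lambda>\<sigma>. (b - \<sigma>) *\<^sub>R (L ** L)) = W s"
      by (auto simp: integral_unique)
    have "?J (Suc (Suc 0)) s = integral {s..b} (\<lambda>\<sigma>. (L + q \<sigma>) ** ?J (Suc 0) \<sigma>)"
      by (rule backward_dyson.simps)
    also have "\<dots> = integral {s..b} (\<lambda>\<sigma>. (b - \<sigma>) *\<^sub>R (L ** L) + L ** q1 \<sigma>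
        + (b - \<sigma>) *\<^sub>R (q \<sigma> ** L) + q \<sigma> ** q1 \<sigma>)"
    proof (rule integral_cong)
      fix \<sigma> assume "\<sigma> \<in> {s..b}"
      then have "\<sigma> \<in> {a..b}" using s by auto
      then show "(L + q \<sigma>) ** ?J (Suc 0) \<sigma> = (b - \<sigma>) *\<^sub>R (L ** L) + L ** q1 \<sigma>
        + (b - \<sigma>) *\<^sub>R (q \<sigma> ** L) + q \<sigma> ** q1 \<sigma>"
        unfolding J1[OF \<open>\<sigma> \<in> {a..b}\<close>]
        by (simp add: matrix_add_ldistrib matrix_add_rdistrib matrix_scalar_ac scalar_matrix_assoc
            scaleR_add_right)
    qed
    also have "\<dots> = W s + X s + Y s + Z s"
      using w tail[OF bmX s] tail[OF bmY s] tail[OF bmZ s]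
      by (simp add: integral_add integrable_add X_def Y_def Z_def)
    finally show ?thesis .
  qed
  have J3: "?J (Suc (Suc (Suc 0))) a
    = integral {a..b} (\<lambda>s. L ** W s) + integral {a..b} (\<lambda>s. L ** X s)
    + integral {a..b} (\<lambda>s. L ** Y s) + integral {a..b} (\<lambda>s. L ** Z s)
    + integral {a..b} (\<lambda>s. q s ** W s) + integral {a..b} (\<lambda>s. q s ** X s)
    + integral {a..b} (\<lambda>s. q s ** Y s) + integral {a..b} (\<lambda>s. q s ** Z s)"
  proof -
    note int = tail[OF bm_mult[OF bm_const W] aab] tail[OF bm_mult[OF bm_const X] aab]
      tail[OF bm_mult[OF bm_const Y] aab] tail[OF bm_mult[OF bm_const Z] aab]
      tail[OF bm_mult[OF q W] aab] tail[OF bm_mult[OF q X] aab]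
      tail[OF bm_mult[OF q Y] aab] tail[OF bm_mult[OF q Z] aab]
    have "?J (Suc (Suc (Suc 0))) a = integral {a..b} (\<lambda>s. (L + q s) ** ?J (Suc (Suc 0)) s)"
      by (rule backward_dyson.simps)
    also have "\<dots> = integral {a..b} (\<lambda>s. L ** W s + L ** X s + L ** Y s + L ** Z s
        + q s ** W s + q s ** X s + q s ** Y s + q s ** Z s)"
    proof (rule integral_cong)
      fix s assume s: "s \<in> {a..b}"
      show "(L + q s) ** ?J (Suc (Suc 0)) s = L ** W s + L ** X s + L ** Y s + L ** Z s
        + q s ** W s + q s ** X s + q s ** Y s + q s ** Z s"
        unfolding J2[OF s]
        by (simp add: matrix_add_ldistrib matrix_add_rdistrib)
    qed
    finally show ?thesis
      by (simp add: integral_add integrable_add int)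
  qed

  \<comment> \<open>The prefactor \<open>A\<close> is \<open>L\<close> in four of the third-order terms and \<open>q s\<close> in the others;
    it does not depend on the inner integration variables.\<close>
  have innerX: "integral {s..b} (\<lambda>\<sigma>. integral {\<sigma>..b} (\<lambda>\<rho>. A ** L ** q \<rho>)) = A ** X s"
    if s: "s \<in> {a..b}" for A :: "real ^ 'n ^ 'n" and s
  proof -
    have "integral {s..b} (\<lambda>\<sigma>. integral {\<sigma>..b} (\<lambda>\<rho>. A ** L ** q \<rho>))
        = integral {s..b} (\<lambda>\<sigma>. A ** (L ** q1 \<sigma>))"
    proof (rule integral_cong)
      fix \<sigma> assume "\<sigma> \<in> {s..b}"
      then have "\<sigma> \<in> {a..b}" using s by auto
      then show "integral {\<sigma>..b} (\<lambda>\<rho>. A ** L ** q \<rho>) = A ** (L ** q1 \<sigma>)"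
        by (simp add: integral_matrix_mult_left[OF tail[OF q]] q1_def matrix_mul_assoc)
    qed
    then show ?thesis by (simp add: integral_matrix_mult_left[OF tail[OF bmX s]] X_def)
  qed
  have innerY: "integral {s..b} (\<lambda>\<sigma>. (b - \<sigma>) *\<^sub>R (A ** q \<sigma> ** L)) = A ** Y s"
    if s: "s \<in> {a..b}" for A :: "real ^ 'n ^ 'n" and s
    using integral_matrix_mult_left[OF tail[OF bmY s], of A]
    by (simp add: Y_def matrix_scalar_ac scalar_matrix_assoc matrix_mul_assoc)
  have innerZ: "integral {s..b} (\<lambda>\<sigma>. integral {\<sigma>..b} (\<lambda>\<rho>. A ** q \<sigma> ** q \<rho>)) = A ** Z s"
    if s: "s \<in> {a..b}" for A :: "real ^ 'n ^ 'n" and s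
  proof -
    have "integral {s..b} (\<lambda>\<sigma>. integral {\<sigma>..b} (\<lambda>\<rho>. A ** q \<sigma> ** q \<rho>))
        = integral {s..b} (\<lambda>\<sigma>. A ** (q \<sigma> ** q1 \<sigma>))"
    proof (rule integral_cong)
      fix \<sigma> assume "\<sigma> \<in> {s..b}"
      then have "\<sigma> \<in> {a..b}" using s by auto
      then show "integral {\<sigma>..b} (\<lambda>\<rho>. A ** q \<sigma> ** q \<rho>) = A ** (q \<sigma> ** q1 \<sigma>)"
        by (simp add: integral_matrix_mult_left[OF tail[OF q]] q1_def matrix_mul_assoc)
    qed
    then show ?thesis by (simp add: integral_matrix_mult_left[OF tail[OF bmZ s]] Z_def)
  qed
  have LLL: "(1 / 2 * integral {a..b} (\<lambda>s. (b - s)\<^sup>2)) *\<^sub>R (L ** L ** L) = integral {a..b} (\<lambda>s. L ** W s)"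
  proof -
    have "((\<lambda>s. (1 / 2 * (b - s)\<^sup>2) *\<^sub>R (L ** L ** L)) has_integral
        (1 / 2 * integral {a..b} (\<lambda>s. (b - s)\<^sup>2)) *\<^sub>R (L ** L ** L)) {a..b}"
      by (intro has_integral_scaleR_left has_integral_mult_right integrable_integral
          tail[OF bm_sq aab])
    then show ?thesis
      by (auto dest!: integral_unique simp: W_def matrix_scalar_ac scalar_matrix_assoc matrix_mul_assoc)
  qed
  have QLL: "(1 / 2) *\<^sub>R integral {a..b} (\<lambda>s. (b - s)\<^sup>2 *\<^sub>R (q s ** L ** L))
      = integral {a..b} (\<lambda>s. q s ** W s)"
    by (simp add: integral_cmul[symmetric] W_def matrix_scalar_ac scalar_matrix_assoc matrix_mul_assoc
        del: integral_cmul)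
  have c3: "corr3 L q dt n = ?J (Suc (Suc (Suc 0))) a"
  proof -
    note cong = integral_cong[OF innerX[of _ L]] integral_cong[OF innerY[of _ L]]
      integral_cong[OF innerZ[of _ L]] integral_cong[OF innerX[of _ "q _"]]
      integral_cong[OF innerY[of _ "q _"]] integral_cong[OF innerZ[of _ "q _"]]
    show ?thesis
      unfolding corr3_def Let_def a_def[symmetric] b_def[symmetric] J3 LLL QLL
      by (simp only: cong)
  qed
  have c2: "corr2 L q dt n = - ?J (Suc (Suc 0)) a"
  proof -
    have "integral {a..b} (\<lambda>s. integral {s..b} (\<lambda>\<sigma>. A s ** q \<sigma>)) = integral {a..b} (\<lambda>s. A s ** q1 s)"
      for A :: "real \<Rightarrow> real ^ 'n ^ 'n"
      by (rule integral_cong) (simp add: integral_matrix_mult_left[OF tail[OF q]] q1_def)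
    then show ?thesis
      unfolding corr2_def Let_def a_def[symmetric] b_def[symmetric] J2[OF aab]
      by (simp add: W_def X_def Y_def Z_def ba)
  qed
  have c1: "step_op1 L q dt n = mat 1 - ?J (Suc 0) a"
    unfolding step_op1_def Let_def a_def[symmetric] b_def[symmetric] J1[OF aab]
    by (simp add: q1_def ba)
  show ?thesis
    unfolding step_op3_def step_op2_def c1 c2 c3 by (simp add: numeral_2_eq_2 numeral_3_eq_3 del: backward_dyson.simps)
qed

section \<open>Solutions of the integrated equation\<close>

text \<open>The right-hand side of the hypothesis, damped by \<open>exp (- \<beta> t)\<close>, has a nonpositive derivative.
  It is differentiable, whereas \<open>f\<close> is only continuous.\<close>

lemma gronwall:
  fixes f :: "real \<Rightarrow> real"
  assumes f: "continuous_on {0..T} f"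
    and le: "\<And>t. t \<in> {0..T} \<Longrightarrow> f t \<le> A + \<beta> * integral {0..t} f"
    and "\<beta> \<ge> 0" and t: "t \<in> {0..T}"
  shows "f t \<le> A * exp (\<beta> * t)"
proof -
  define \<phi> where "\<phi> t = A + \<beta> * integral {0..t} f" for t
  have cont: "continuous_on {0..T} \<phi>"
    unfolding \<phi>_def
    by (intro continuous_intros indefinite_integral_continuous_1 integrable_continuous_real f)
  have "\<phi> t * exp (- \<beta> * t) \<le> \<phi> 0 * exp (- \<beta> * 0)"
  proof (rule DERIV_nonpos_imp_decreasing_open[where f = "\<lambda>t. \<phi> t * exp (- \<beta> * t)"])
    show "continuous_on {0..t} (\<lambda>t. \<phi> t * exp (- \<beta> * t))"
      by (intro continuous_intros continuous_on_subset[OF cont]) (use t in auto)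
    fix x assume x: "0 < x" "x < t"
    then have "(\<phi> has_real_derivative \<beta> * f x) (at x)"
      using integral_has_vector_derivative[OF f, of x] t
      unfolding \<phi>_def
      by (auto intro!: derivative_eq_intros
          simp: has_real_derivative_iff_has_vector_derivative[symmetric] at_within_Icc_at)
    then have "((\<lambda>t. \<phi> t * exp (- \<beta> * t)) has_real_derivative
        \<beta> * (f x - \<phi> x) * exp (- \<beta> * x)) (at x)"
      by (auto intro!: derivative_eq_intros simp: algebra_simps)
    moreover have "\<beta> * (f x - \<phi> x) * exp (- \<beta> * x) \<le> 0"
      using le[of x] x t \<open>\<beta> \<ge> 0\<close>
      by (intro mult_nonpos_nonneg mult_nonneg_nonpos) (auto simp: \<phi>_def)
    ultimately show "\<exists>y. ((\<lambda>t. \<phi> t * exp (- \<beta> * t)) has_real_derivative y) (at x) \<and> y \<le> 0"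
      by blast
  qed (use t in auto)
  then have "\<phi> t \<le> A * exp (\<beta> * t)"
    by (simp add: \<phi>_def exp_minus field_simps)
  then show ?thesis using le[OF t] by (simp add: \<phi>_def)
qed

lemma solves_ode_continuous:
  assumes "solves_ode T B c0 c"
  shows "continuous_on {0..T} c"
proof (cases "0 \<le> T")
  case True
  have "(\<lambda>s. B s *v c s) integrable_on {0..T}"
    using assms True by (auto simp: solves_ode_def)
  from indefinite_integral_continuous_1[OF this]
  have "continuous_on {0..T} (\<lambda>t. c 0 + integral {0..t} (\<lambda>s. B s *v c s))"
    by (intro continuous_intros)
  moreover have "c 0 + integral {0..t} (\<lambda>s. B s *v c s) = c t" if "t \<in> {0..T}" for t
    using assms that by (auto simp: solves_ode_def dest!: bspec[OF _ that] integral_unique)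
  ultimately show ?thesis by (rule continuous_on_eq)
qed simp

text \<open>The coefficients may be discontinuous, so \<open>c\<close> need not be differentiable; Gronwall's inequality is
  applied to the integrated equation.\<close>

lemma solves_ode_norm_le:
  assumes ode: "solves_ode T B c0 c"
    and bd: "\<And>s x. norm (B s *v x) \<le> \<beta> * norm x" and "\<beta> \<ge> 0"
    and t: "t \<in> {0..T}"
  shows "norm (c t) \<le> norm c0 * exp (\<beta> * T)"
proof -
  have cont: "continuous_on {0..T} (\<lambda>t. norm (c t))"
    by (intro continuous_intros solves_ode_continuous[OF ode])
  have "norm (c t) \<le> norm c0 * exp (\<beta> * t)"
  proof (rule gronwall[OF cont _ \<open>\<beta> \<ge> 0\<close> t])
    fix t assume t: "t \<in> {0..T}"
    have int: "((\<lambda>s. B s *v c s) has_integral (c t - c0)) {0..t}"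
      using ode t by (auto simp: solves_ode_def)
    have "(\<lambda>s. norm (c s)) integrable_on {0..t}"
      by (intro integrable_continuous_real continuous_on_subset[OF cont]) (use t in auto)
    then have n: "(\<lambda>s. \<beta> * norm (c s)) integrable_on {0..t}"
      using integrable_cmul[of _ _ \<beta>] by fastforce
    have "norm (c t - c0) \<le> integral {0..t} (\<lambda>s. \<beta> * norm (c s))"
      using integral_norm_bound_integral[OF has_integral_integrable[OF int] n bd] int
      by (simp add: integral_unique)
    then show "norm (c t) \<le> norm c0 + \<beta> * integral {0..t} (\<lambda>s. norm (c s))"
      using norm_triangle_sub[of "c t" c0] by simp
  qed
  also have "\<dots> \<le> norm c0 * exp (\<beta> * T)"
    using t \<open>\<beta> \<ge> 0\<close> by (intro mult_left_mono) (auto intro: mult_left_mono)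
  finally show ?thesis .
qed

lemma solves_ode_increment:
  assumes ode: "solves_ode T B c0 c" and "0 \<le> s" "s \<le> b" "b \<le> T"
  shows "c b - c s = integral {s..b} (\<lambda>\<sigma>. B \<sigma> *v c \<sigma>)"
proof -
  have int: "((\<lambda>s. B s *v c s) has_integral (c t - c 0)) {0..t}" if "t \<in> {0..T}" for t
    using ode that by (auto simp: solves_ode_def)
  have "(c s - c 0) + integral {s..b} (\<lambda>\<sigma>. B \<sigma> *v c \<sigma>) = c b - c 0"
    using Henstock_Kurzweil_Integration.integral_combine[OF _ _ has_integral_integrable[OF int[of b]], of s]
      integral_unique[OF int[of b]] integral_unique[OF int[of s]] assms(2-)
    by auto
  then show ?thesis by (simp add: algebra_simps)
qed

section \<open>Stability and consistency of one step\<close>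

text \<open>In \<open>x = A x + J\<^sub>1 x - J\<^sub>2 x + J\<^sub>3 x\<close>, with \<open>A\<close> the step operator, each of the last three terms has norm at
  most \<open>\<beta> dt * norm x\<close>, because \<open>\<beta> dt \<le> 1\<close>.\<close>

lemma step_op3_lower_bound:
  fixes L :: "real ^ 'n::finite ^ 'n" and n :: nat
  assumes q: "bounded_measurable (real n * dt) (real (n + 1) * dt) q"
    and bd: "\<And>s x. norm ((L + q s) *v x) \<le> \<beta> * norm x"
    and "\<beta> \<ge> 0" "dt \<ge> 0" "\<beta> * dt \<le> 1"
  shows "(1 - 3 * (\<beta> * dt)) * norm x \<le> norm (step_op3 L q dt n *v x)"
proof -
  let ?a = "real n * dt" and ?b = "real (n + 1) * dt"
  let ?J = "\<lambda>k. backward_dyson (\<lambda>s. L + q s) ?b k ?a *v x"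
  have J: "norm (?J k) \<le> \<beta> * dt * norm x" if "k \<ge> 1" for k
  proof -
    have "norm (?J k) \<le> (\<beta> * (?b - ?a)) ^ k * norm x"
      using \<open>\<beta> \<ge> 0\<close> \<open>dt \<ge> 0\<close>
      by (intro norm_backward_dyson_le bounded_measurable_add bounded_measurable_const q bd)
         (auto simp: algebra_simps)
    also have "\<dots> = (\<beta> * dt) ^ k * norm x" by (simp add: algebra_simps)
    also have "\<dots> \<le> (\<beta> * dt) ^ 1 * norm x"
      using assms that by (intro mult_right_mono power_decreasing) auto
    finally show ?thesis by simp
  qed
  have "x = step_op3 L q dt n *v x + ?J 1 - ?J 2 + ?J 3"
    unfolding step_op3_eq_dyson[OF \<open>dt \<ge> 0\<close> q]
    by (simp add: matrix_vector_mult_add_rdistrib matrix_vector_mult_diff_rdistrib del: backward_dyson.simps)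
  then have "norm x \<le> norm (step_op3 L q dt n *v x) + norm (?J 1) + norm (?J 2) + norm (?J 3)"
    by (smt (verit) norm_triangle_ineq norm_triangle_ineq4)
  then show ?thesis using J[of 1] J[of 2] J[of 3] by (simp add: algebra_simps)
qed

text \<open>The local error is the remainder of the Dyson series after four terms. The factor
  \<open>norm c0 * exp (\<beta> * T)\<close> is the Gronwall bound for the solution on the whole time interval, so the
  estimate does not depend on the number of the step.\<close>

lemma step_op3_consistency:
  fixes L :: "real ^ 'n::finite ^ 'n" and n :: nat and dt :: real
  defines "a \<equiv> real n * dt" and "b \<equiv> real (n + 1) * dt"
  assumes ode: "solves_ode T (\<lambda>s. L + q s) c0 c" and "dt \<ge> 0" and "b \<le> T"
    and q: "bounded_measurable a b q"
    and bd: "\<And>s x. norm ((L + q s) *v x) \<le> \<beta> * norm x" and "\<beta> \<ge> 0"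
  shows "norm (c a - step_op3 L q dt n *v c b) \<le> (\<beta> * dt) ^ 4 * (norm c0 * exp (\<beta> * T))"
proof -
  have ab: "0 \<le> a" "a \<le> b" "b - a = dt"
    using \<open>dt \<ge> 0\<close> by (auto simp: a_def b_def algebra_simps)
  have "bounded_measurable a b c"
    using ab \<open>b \<le> T\<close>
    by (intro bounded_measurable_continuous continuous_on_subset[OF solves_ode_continuous[OF ode]]) auto
  then have "norm (c a - (\<Sum>j<4. (- 1) ^ j *\<^sub>R (backward_dyson (\<lambda>s. L + q s) b j a *v c b)))
      \<le> (\<beta> * (b - a)) ^ 4 * (norm c0 * exp (\<beta> * T))"
    using ab \<open>b \<le> T\<close>
    by (intro dyson_remainder bounded_measurable_add bounded_measurable_const q bd \<open>\<beta> \<ge> 0\<close>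
        solves_ode_norm_le[OF ode bd] solves_ode_increment[OF ode]) auto
  moreover have "(\<Sum>j<4. (- 1) ^ j *\<^sub>R (backward_dyson (\<lambda>s. L + q s) b j a *v c b))
      = step_op3 L q dt n *v c b"
    unfolding step_op3_eq_dyson[OF \<open>dt \<ge> 0\<close> q[unfolded a_def b_def], folded a_def b_def]
    by (simp add: eval_nat_numeral matrix_vector_mult_add_rdistrib matrix_vector_mult_diff_rdistrib
        del: backward_dyson.simps(2))
  ultimately show ?thesis by (simp add: ab)
qed

section \<open>Error accumulation\<close>

lemma invertible_of_norm_lower_bound:
  fixes A :: "real ^ 'n::finite ^ 'n"
  assumes "\<kappa> < 1" and "\<And>x. (1 - \<kappa>) * norm x \<le> norm (A *v x)"
  shows "invertible A"
proof -
  have "x = 0" if "A *v x = 0" for x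
    using assms(2)[of x] assms(1) that by (simp add: mult_le_0_iff)
  then show ?thesis
    unfolding invertible_left_inverse matrix_left_invertible_ker by blast
qed

text \<open>The discrete analogue of Gronwall's inequality. Since \<open>A n\<close> maps the new error to the old one up to
  the local error \<open>\<rho>\<close>, the lower bound on \<open>A n\<close> gives
  \<open>(1 - \<kappa>) e\<^sub>n\<^sub>+\<^sub>1 \<le> e\<^sub>n + \<rho>\<close>, and \<open>1 / (1 - \<kappa>) \<le> exp (2 \<kappa>)\<close> for \<open>\<kappa> \<le> 1/2\<close>.\<close>

lemma implicit_scheme_error:
  fixes A :: "nat \<Rightarrow> real ^ 'n::finite ^ 'n"
  assumes stable: "\<And>n x. n < M \<Longrightarrow> (1 - \<kappa>) * norm x \<le> norm (A n *v x)"
    and consistent: "\<And>n. n < M \<Longrightarrow> norm (y n - A n *v y (Suc n)) \<le> \<rho>"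
    and "0 \<le> \<kappa>" "\<kappa> \<le> 1/2" "0 \<le> \<rho>"
    and "n \<le> M"
  shows "norm (y n - implicit_scheme A (y 0) n) \<le> real n * \<rho> * exp (2 * \<kappa> * real n)"
  using \<open>n \<le> M\<close>
proof (induction n)
  case 0
  show ?case by simp
next
  case (Suc n)
  let ?z = "implicit_scheme A (y 0)"
  have n: "n < M" using Suc.prems by simp
  have "invertible (A n)"
    by (rule invertible_of_norm_lower_bound[of \<kappa>]) (use \<open>\<kappa> \<le> 1/2\<close> stable[OF n] in auto)
  then have "A n ** matrix_inv (A n) = mat 1"
    unfolding invertible_def matrix_inv_def by (rule someI2_ex) blast
  then have "A n *v ?z (Suc n) = ?z n"
    by (simp add: matrix_vector_mul_assoc)
  then have "A n *v (y (Suc n) - ?z (Suc n)) = (y n - ?z n) - (y n - A n *v y (Suc n))"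
    by (simp add: matrix_vector_mult_diff_distrib del: implicit_scheme.simps)
  then have "norm (A n *v (y (Suc n) - ?z (Suc n))) \<le> norm (y n - ?z n) + \<rho>"
    using norm_triangle_ineq4[of "y n - ?z n" "y n - A n *v y (Suc n)"] consistent[OF n] by simp
  with stable[OF n] Suc.IH n
  have *: "(1 - \<kappa>) * norm (y (Suc n) - ?z (Suc n)) \<le> real n * \<rho> * exp (2 * \<kappa> * real n) + \<rho>"
    by (smt (verit) less_imp_le)
  have "1 \<le> (1 - \<kappa>) * (1 + 2 * \<kappa>)"
    using mult_nonneg_nonneg[of \<kappa> "1 - 2 * \<kappa>"] \<open>0 \<le> \<kappa>\<close> \<open>\<kappa> \<le> 1/2\<close>
    by (simp add: algebra_simps)
  also have "\<dots> \<le> (1 - \<kappa>) * exp (2 * \<kappa>)"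
    using \<open>\<kappa> \<le> 1/2\<close> by (intro mult_left_mono) (auto simp: add.commute)
  finally have amp: "1 \<le> (1 - \<kappa>) * exp (2 * \<kappa>)" .
  have "norm (y (Suc n) - ?z (Suc n)) \<le> ((1 - \<kappa>) * exp (2 * \<kappa>)) * norm (y (Suc n) - ?z (Suc n))"
    using mult_right_mono[OF amp norm_ge_zero] by simp
  also have "\<dots> = exp (2 * \<kappa>) * ((1 - \<kappa>) * norm (y (Suc n) - ?z (Suc n)))" by simp
  also have "\<dots> \<le> exp (2 * \<kappa>) * (real n * \<rho> * exp (2 * \<kappa> * real n) + \<rho>)"
    by (rule mult_left_mono[OF *]) simp
  also have "\<dots> \<le> exp (2 * \<kappa>) * (real n * \<rho> * exp (2 * \<kappa> * real n) + \<rho> * exp (2 * \<kappa> * real n))"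
    using \<open>0 \<le> \<rho>\<close> \<open>0 \<le> \<kappa>\<close> by (intro mult_left_mono add_left_mono mult_le_cancel_left1[THEN iffD2]) auto
  also have "\<dots> = real (Suc n) * \<rho> * exp (2 * \<kappa> * real (Suc n))"
    by (simp add: algebra_simps exp_add)
  finally show ?case .
qed

section \<open>Equivalence of norms\<close>

lemma is_norm_le_norm:
  fixes nrm :: "'a::euclidean_space \<Rightarrow> real"
  assumes "is_norm nrm"
  shows "\<exists>K>0. \<forall>x. nrm x \<le> K * norm x"
proof -
  have zero: "nrm 0 = 0" and tri: "nrm (x + y) \<le> nrm x + nrm y"
    and scale: "nrm (r *\<^sub>R x) = \<bar>r\<bar> * nrm x" and pos: "0 \<le> nrm x" for r x y
    using assms by (auto simp: is_norm_def)
  have sum: "nrm (\<Sum>i\<in>I. f i) \<le> (\<Sum>i\<in>I. nrm (f i))" if "finite I" for I and f :: "'a \<Rightarrow> 'a"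
    using that
  proof induction
    case (insert i I)
    then show ?case using tri[of "f i" "sum f I"] by simp
  qed (simp add: zero)
  have "nrm x \<le> (1 + (\<Sum>b\<in>Basis. nrm b)) * norm x" for x
  proof -
    have "nrm x = nrm (\<Sum>b\<in>Basis. (x \<bullet> b) *\<^sub>R b)" by (simp add: euclidean_representation)
    also have "\<dots> \<le> (\<Sum>b\<in>Basis. \<bar>x \<bullet> b\<bar> * nrm b)"
      using sum[of Basis "\<lambda>b. (x \<bullet> b) *\<^sub>R b"] by (simp add: scale)
    also have "\<dots> \<le> (\<Sum>b\<in>Basis. norm x * nrm b)"
      by (intro sum_mono mult_right_mono Basis_le_norm pos)
    also have "\<dots> \<le> (1 + (\<Sum>b\<in>Basis. nrm b)) * norm x"
      by (simp add: sum_distrib_left[symmetric] algebra_simps)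
    finally show ?thesis .
  qed
  moreover have "1 + (\<Sum>b\<in>Basis. nrm b) > 0"
    using sum_nonneg[of Basis nrm] pos by simp
  ultimately show ?thesis by blast
qed

text \<open>By the reverse estimate the norm \<open>nrm\<close> is Lipschitz, so it attains a minimum on the compact unit
  sphere. The minimum is positive by definiteness, and its inverse serves as the constant.\<close>

lemma norm_le_is_norm:
  fixes nrm :: "'a::euclidean_space \<Rightarrow> real"
  assumes nrm: "is_norm nrm"
  shows "\<exists>K>0. \<forall>x. norm x \<le> K * nrm x"
proof -
  have tri: "nrm (x + y) \<le> nrm x + nrm y" and scale: "nrm (r *\<^sub>R x) = \<bar>r\<bar> * nrm x"
    and eq0: "nrm x = 0 \<longleftrightarrow> x = 0" and pos: "0 \<le> nrm x" for r x y
    using nrm by (auto simp: is_norm_def)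
  obtain K where K: "K > 0" "\<And>x. nrm x \<le> K * norm x" using is_norm_le_norm[OF nrm] by blast
  have diff: "nrm x - nrm y \<le> K * dist x y" for x y
    using tri[of "x - y" y] K(2)[of "x - y"] by (simp add: dist_norm)
  have "K-lipschitz_on UNIV nrm"
  proof (rule lipschitz_onI)
    show "dist (nrm x) (nrm y) \<le> K * dist x y" for x y
      using diff[of x y] diff[of y x] by (simp add: dist_real_def dist_commute)
  qed (use K in auto)
  then have "continuous_on (sphere 0 1) nrm"
    using lipschitz_on_continuous_on continuous_on_subset by blast
  moreover have "sphere (0::'a) 1 \<noteq> {}" using vector_choose_size[of 1] by force
  ultimately obtain z where z: "norm z = 1" "\<And>x. norm x = 1 \<Longrightarrow> nrm z \<le> nrm x"
    using continuous_attains_inf[of "sphere (0::'a) 1" nrm] by auto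
  have "nrm z > 0" using eq0[of z] pos[of z] z(1) by force
  have "norm x \<le> (1 / nrm z) * nrm x" for x
  proof (cases "x = 0")
    case False
    then have "nrm z \<le> nrm ((1 / norm x) *\<^sub>R x)" by (intro z(2)) simp
    with False \<open>nrm z > 0\<close> show ?thesis by (simp add: scale field_simps)
  qed (simp add: pos)
  with \<open>nrm z > 0\<close> show ?thesis by (intro exI[of _ "1 / nrm z"]) auto
qed

section \<open>Third-order convergence uniformly in the period\<close>

theorem proposition3:
  fixes h D t_fin \<epsilon>0 :: real
    and G P :: "(int \<times> int) set"
    and p :: "'n::finite \<Rightarrow> int \<times> int"
    and L :: "real ^ 'n ^ 'n"
    and Q :: "(real ^ 'n) \<times> (real ^ 'n) \<Rightarrow> real ^ 'n ^ 'n"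
    and u :: "real \<Rightarrow> (real ^ 'n) \<times> (real ^ 'n)"
    and nrm :: "real ^ 'n \<Rightarrow> real"
  assumes "h > 0" and "D > 0"
    and "domain_grid h G P"
    and "bij_betw p UNIV P"
    and "diffusion_rows D h G p L"
    and "linear Q"
    and "advection_rows h G p Q"
    and "is_norm nrm"
    and "\<epsilon>0 > 0" and "t_fin > 0"
    and "u \<in> borel_measurable lebesgue"
    and "bounded (range u)"
    and "\<forall>t. u (t + 1) = u t"
  shows "\<exists>dt0 > 0.
    (\<forall>\<epsilon>\<in>{0<..\<epsilon>0}. \<forall>M::nat. M \<ge> 1 \<longrightarrow> t_fin / real M < dt0 \<longrightarrow>
       (\<forall>n<M. invertible (step_op3 L (\<lambda>s. Q (u (s / \<epsilon>))) (t_fin / real M) n))) \<and>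
    (\<forall>C0. \<exists>K. \<forall>(c0 :: real \<Rightarrow> real ^ 'n) (c :: real \<Rightarrow> real \<Rightarrow> real ^ 'n).
       (\<forall>\<epsilon>\<in>{0<..\<epsilon>0}. nrm (c0 \<epsilon>) \<le> C0 \<and>
          solves_ode t_fin (\<lambda>s. L + Q (u (s / \<epsilon>))) (c0 \<epsilon>) (c \<epsilon>)) \<longrightarrow>
       (\<forall>\<epsilon>\<in>{0<..\<epsilon>0}. \<forall>M::nat. M \<ge> 1 \<longrightarrow> t_fin / real M < dt0 \<longrightarrow>
          (\<forall>n\<in>{1..M}.
             nrm (c \<epsilon> (real n * (t_fin / real M))
                  - implicit_scheme (step_op3 L (\<lambda>s. Q (u (s / \<epsilon>))) (t_fin / real M)) (c \<epsilon> 0) n)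
             \<le> K * (t_fin / real M) ^ 3)))"
proof -
  let ?q = "\<lambda>\<epsilon> s. Q (u (s / \<epsilon>))"
  have q: "bounded_measurable a b (?q \<epsilon>)" for a b \<epsilon>
    by (rule linear_image_rescaled_measurable) fact+
  \<comment> \<open>One bound for all \<open>\<epsilon>\<close>: it is taken over the range of \<open>u\<close>, which no rescaling of time changes.\<close>
  obtain \<beta> where "\<beta> > 0" and bd: "\<And>\<epsilon> s x. norm ((L + ?q \<epsilon> s) *v x) \<le> \<beta> * norm x"
  proof -
    obtain m where m: "m > 0" "\<And>(A :: real^'n^'n) x. norm (A *v x) \<le> norm A * norm x * m"
      using bounded_bilinear.pos_bounded[OF bounded_bilinear_matrix_vector_mult] by metis
    have "bounded (range (\<lambda>t. Q (u t)))"
      using bounded_linear_image[OF \<open>bounded (range u)\<close>, of Q] \<open>linear Q\<close>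
      by (simp add: linear_conv_bounded_linear image_image)
    then obtain F where F: "F > 0" "\<And>t. norm (Q (u t)) \<le> F"
      by (auto simp: bounded_pos)
    show ?thesis
    proof (rule that[of "(norm L + F) * m"])
      show "(norm L + F) * m > 0" using m F by (simp add: add_nonneg_pos)
      show "norm ((L + ?q \<epsilon> s) *v x) \<le> (norm L + F) * m * norm x" for \<epsilon> s x
      proof -
        have "norm (L + ?q \<epsilon> s) * (norm x * m) \<le> (norm L + F) * (norm x * m)"
          using F(2) m(1) norm_triangle_mono[OF order_refl F(2)]
          by (intro mult_right_mono) auto
        then show ?thesis using m(2)[of "L + ?q \<epsilon> s" x] by (simp add: mult_ac)
      qed
    qed
  qed
  obtain K1 where K1: "K1 > 0" "\<And>x. nrm x \<le> K1 * norm x"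
    using is_norm_le_norm[OF \<open>is_norm nrm\<close>] by blast
  obtain K2 where K2: "K2 > 0" "\<And>x. norm x \<le> K2 * nrm x"
    using norm_le_is_norm[OF \<open>is_norm nrm\<close>] by blast
  \<comment> \<open>Steps below \<open>dt0\<close> satisfy \<open>3 * (\<beta> * dt) < 1/2\<close>, the smallness required to sum up the errors.\<close>
  define dt0 where "dt0 = 1 / (6 * \<beta>)"
  have stable: "(1 - 3 * (\<beta> * dt)) * norm x \<le> norm (step_op3 L (?q \<epsilon>) dt n *v x)"
    if "0 \<le> dt" "dt < dt0" for dt \<epsilon> n x
    using that \<open>\<beta> > 0\<close>
    by (intro step_op3_lower_bound q bd) (auto simp: dt0_def field_simps)
  show ?thesis
  proof (rule exI[of _ dt0], intro conjI ballI allI impI)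
    show "dt0 > 0" using \<open>\<beta> > 0\<close> by (simp add: dt0_def)
    fix \<epsilon> :: real and M n :: nat
    assume dt: "t_fin / real M < dt0"
    show "invertible (step_op3 L (?q \<epsilon>) (t_fin / real M) n)"
    proof (rule invertible_of_norm_lower_bound[OF _ stable[OF _ dt]])
      have "\<beta> * (t_fin / real M) < \<beta> * dt0" using dt \<open>\<beta> > 0\<close> by (rule mult_strict_left_mono)
      also have "\<beta> * dt0 = 1 / 6" using \<open>\<beta> > 0\<close> by (simp add: dt0_def)
      finally show "3 * (\<beta> * (t_fin / real M)) < 1" by linarith
    qed (use \<open>t_fin > 0\<close> in simp)
  next
    fix C0 :: real
    define C1 where "C1 = K2 * C0 * exp (\<beta> * t_fin)"
    define K where "K = K1 * (t_fin * \<beta> ^ 4 * C1 * exp (6 * \<beta> * t_fin))"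
    show "\<exists>K. \<forall>(c0 :: real \<Rightarrow> real ^ 'n) (c :: real \<Rightarrow> real \<Rightarrow> real ^ 'n).
       (\<forall>\<epsilon>\<in>{0<..\<epsilon>0}. nrm (c0 \<epsilon>) \<le> C0 \<and>
          solves_ode t_fin (\<lambda>s. L + ?q \<epsilon> s) (c0 \<epsilon>) (c \<epsilon>)) \<longrightarrow>
       (\<forall>\<epsilon>\<in>{0<..\<epsilon>0}. \<forall>M::nat. M \<ge> 1 \<longrightarrow> t_fin / real M < dt0 \<longrightarrow>
          (\<forall>n\<in>{1..M}.
             nrm (c \<epsilon> (real n * (t_fin / real M))
                  - implicit_scheme (step_op3 L (?q \<epsilon>) (t_fin / real M)) (c \<epsilon> 0) n)
             \<le> K * (t_fin / real M) ^ 3))"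
    proof (intro exI[of _ K] allI impI ballI)
      fix c0 :: "real \<Rightarrow> real ^ 'n" and c :: "real \<Rightarrow> real \<Rightarrow> real ^ 'n" and \<epsilon> :: real and M n :: nat
      assume "\<forall>\<epsilon>\<in>{0<..\<epsilon>0}. nrm (c0 \<epsilon>) \<le> C0 \<and> solves_ode t_fin (\<lambda>s. L + ?q \<epsilon> s) (c0 \<epsilon>) (c \<epsilon>)"
        and "\<epsilon> \<in> {0<..\<epsilon>0}" and "M \<ge> 1" and small: "t_fin / real M < dt0" and n: "n \<in> {1..M}"
      then have c0: "nrm (c0 \<epsilon>) \<le> C0"
        and ode: "solves_ode t_fin (\<lambda>s. L + ?q \<epsilon> s) (c0 \<epsilon>) (c \<epsilon>)" by auto
      define dt where "dt = t_fin / real M"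
      define C where "C = norm (c0 \<epsilon>) * exp (\<beta> * t_fin)"
      let ?A = "step_op3 L (?q \<epsilon>) dt"
      have dt: "0 \<le> dt" "dt < dt0" "real M * dt = t_fin"
        using \<open>t_fin > 0\<close> \<open>M \<ge> 1\<close> small by (auto simp: dt_def)
      have C: "0 \<le> C" "C \<le> C1"
        using order_trans[OF K2(2) mult_left_mono[OF c0]] K2(1) by (auto simp: C_def C1_def)
      have n_dt: "real k * dt \<le> t_fin" if "k \<le> M" for k
        using mult_right_mono[of "real k" "real M" dt] that dt by simp
      have "norm (c \<epsilon> (real n * dt) - implicit_scheme ?A (c \<epsilon> (real 0 * dt)) n)
          \<le> real n * ((\<beta> * dt) ^ 4 * C) * exp (2 * (3 * (\<beta> * dt)) * real n)"
      proof (rule implicit_scheme_error[where M = M and y = "\<lambda>k. c \<epsilon> (real k * dt)"])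
        show "(1 - 3 * (\<beta> * dt)) * norm x \<le> norm (?A k *v x)" for k x
          using stable[OF dt(1,2)] .
        show "norm (c \<epsilon> (real k * dt) - ?A k *v c \<epsilon> (real (Suc k) * dt)) \<le> (\<beta> * dt) ^ 4 * C"
          if "k < M" for k
          using step_op3_consistency[OF ode dt(1) _ q bd, of k] n_dt[of "Suc k"] that \<open>\<beta> > 0\<close>
          by (simp add: C_def)
        show "3 * (\<beta> * dt) \<le> 1 / 2" using dt \<open>\<beta> > 0\<close> by (simp add: dt0_def field_simps)
      qed (use n dt \<open>\<beta> > 0\<close> C in auto)
      also have "\<dots> = (real n * dt) * \<beta> ^ 4 * C * exp (6 * \<beta> * (real n * dt)) * dt ^ 3"
        by (simp add: eval_nat_numeral mult_ac)
      also have "\<dots> \<le> t_fin * \<beta> ^ 4 * C1 * exp (6 * \<beta> * t_fin) * dt ^ 3"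
        using n_dt[of n] n dt \<open>\<beta> > 0\<close> C \<open>t_fin > 0\<close>
        by (intro mult_right_mono mult_mono mult_nonneg_nonneg) auto
      finally have "K1 * norm (c \<epsilon> (real n * dt) - implicit_scheme ?A (c \<epsilon> 0) n) \<le> K * dt ^ 3"
        using mult_left_mono[of _ _ K1] K1(1) by (fastforce simp: K_def mult.assoc)
      then show "nrm (c \<epsilon> (real n * (t_fin / real M))
          - implicit_scheme (step_op3 L (?q \<epsilon>) (t_fin / real M)) (c \<epsilon> 0) n) \<le> K * (t_fin / real M) ^ 3"
        using K1(2) order_trans unfolding dt_def by blast
    qed
  qed
qed

end
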